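(* Let $A=\bigoplus_{d\ge0}A_d$ be an $\mathbb N$-graded commutative ring on which a finite group $G$ acts by degree-preserving ring automorphisms. Assume $\beta(A)\le 1$ and that $|G|$ is invertible in $A$. Let $H\subseteq G$ be a subgroup. Then $$\beta(A^G)\le [G:H]\,\beta(A(H)^H).$$
   Context: For an $\mathbb N$-graded commutative ring $A=\bigoplus_{d\ge0}A_d$ put $A_{\le n}:=\bigoplus_{d=0}^nA_d$ and $\beta(A):=\inf\{n\in\mathbb N\mid A\text{ is generated as a ring by }A_{\le n}\}$, with $\mathbb N=\{0,1,2,\dots\}$ and $\inf\emptyset=\infty$. For a finite group $H$ acting on $A$ by degree-preserving automorphisms, $A(H)$ denotes the polynomial ring over $A$ in $|H|$ variables $\{x_h\mid h\in H\}$, with the $H$-action on $A$ extended by $g\,x_h:=x_{gh}$ and graded by the total degree with $\deg x_h=1$ (and elements of $A_d$ having degree $d$). A superscript $G$ or $H$ denotes the graded subring of invariants. *)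

theory Defs
  imports
    "HOL-Library.Poly_Mapping"
    "HOL-Library.Extended_Nat"
    "HOL-Algebra.Coset"
    "HOL-Algebra.Group_Action"
begin

text \<open>
  The sort \<open>{comm_ring, comm_monoid_mult}\<close> describes commutative rings with identity, without the
  axiom \<open>0 \<noteq> 1\<close> of \<open>comm_ring_1\<close>: the zero ring is included.
\<close>

locale graded_comm_ring =
  fixes A :: "nat \<Rightarrow> 'a :: {comm_ring, comm_monoid_mult} set"
  assumes zero_mem: "0 \<in> A d"
    and add_mem: "\<lbrakk>a \<in> A d; b \<in> A d\<rbrakk> \<Longrightarrow> a + b \<in> A d"
    and uminus_mem: "a \<in> A d \<Longrightarrow> - a \<in> A d"
    and one_mem: "1 \<in> A 0"
    and mult_mem: "\<lbrakk>a \<in> A i; b \<in> A j\<rbrakk> \<Longrightarrow> a * b \<in> A (i + j)"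
    and direct_sum:
      "\<exists>!f. (\<forall>d. f d \<in> A d) \<and> finite {d. f d \<noteq> 0} \<and> a = (\<Sum>d | f d \<noteq> 0. f d)"

text \<open>The action need not be faithful.\<close>

locale graded_ring_action = graded_comm_ring A + group_action G UNIV \<phi>
  for G :: "('g, 'm) monoid_scheme"
    and A :: "nat \<Rightarrow> 'a :: {comm_ring, comm_monoid_mult} set"
    and \<phi> :: "'g \<Rightarrow> 'a \<Rightarrow> 'a" +
  assumes action_add: "g \<in> carrier G \<Longrightarrow> \<phi> g (a + b) = \<phi> g a + \<phi> g b"
    and action_mult: "g \<in> carrier G \<Longrightarrow> \<phi> g (a * b) = \<phi> g a * \<phi> g b"
    and action_one: "g \<in> carrier G \<Longrightarrow> \<phi> g 1 = 1"
    and action_degree: "\<lbrakk>g \<in> carrier G; a \<in> A d\<rbrakk> \<Longrightarrow> \<phi> g a \<in> A d"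

text \<open>
  The identity element \<open>e\<close> is a parameter because the constant \<open>1\<close> on \<open>poly_mapping\<close> is only
  available over coefficients satisfying \<open>0 \<noteq> 1\<close>.
\<close>

inductive_set subring_generated :: "'r :: comm_ring \<Rightarrow> 'r set \<Rightarrow> 'r set"
  for e :: 'r and S :: "'r set"
  where
    one: "e \<in> subring_generated e S"
  | incl: "a \<in> S \<Longrightarrow> a \<in> subring_generated e S"
  | uminus: "a \<in> subring_generated e S \<Longrightarrow> - a \<in> subring_generated e S"
  | add: "\<lbrakk>a \<in> subring_generated e S; b \<in> subring_generated e S\<rbrakk> \<Longrightarrow> a + b \<in> subring_generated e S"
  | mult: "\<lbrakk>a \<in> subring_generated e S; b \<in> subring_generated e S\<rbrakk> \<Longrightarrow> a * b \<in> subring_generated e S"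

definition degree_upto :: "(nat \<Rightarrow> 'r :: comm_ring set) \<Rightarrow> nat \<Rightarrow> 'r set" where
  "degree_upto R n = {\<Sum>d\<le>n. f d | f. \<forall>d\<le>n. f d \<in> R d}"

text \<open>
  \<open>\<beta>\<close> of the graded ring with identity \<open>e\<close>, underlying set \<open>C\<close> and homogeneous components \<open>R d\<close>.
  In \<open>enat\<close>, the infimum of the empty set is \<open>\<infinity>\<close>.
\<close>

definition beta :: "'r :: comm_ring \<Rightarrow> 'r set \<Rightarrow> (nat \<Rightarrow> 'r set) \<Rightarrow> enat" where
  "beta e C R = Inf {enat n | n. subring_generated e (degree_upto R n) = C}"

definition invariants :: "'g set \<Rightarrow> ('g \<Rightarrow> 'r \<Rightarrow> 'r) \<Rightarrow> 'r set \<Rightarrow> 'r set" where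
  "invariants H \<psi> C = {a \<in> C. \<forall>h\<in>H. \<psi> h a = a}"

type_synonym ('v, 'a) mpoly = "('v \<Rightarrow>\<^sub>0 nat) \<Rightarrow>\<^sub>0 'a"

definition polys :: "'v set \<Rightarrow> ('v, 'a :: zero) mpoly set" where
  "polys V = {p. \<forall>m \<in> Poly_Mapping.keys p. Poly_Mapping.keys m \<subseteq> V}"

definition poly_one :: "('v, 'a :: {zero, one}) mpoly" where
  "poly_one = Poly_Mapping.single 0 1"

definition monomial_degree :: "('v \<Rightarrow>\<^sub>0 nat) \<Rightarrow> nat" where
  "monomial_degree m = (\<Sum>v \<in> Poly_Mapping.keys m. Poly_Mapping.lookup m v)"

definition poly_component :: "(nat \<Rightarrow> 'a :: zero set) \<Rightarrow> 'v set \<Rightarrow> nat \<Rightarrow> ('v, 'a) mpoly set" where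
  "poly_component A V d = {p \<in> polys V. \<forall>m \<in> Poly_Mapping.keys p.
     \<exists>i. i + monomial_degree m = d \<and> Poly_Mapping.lookup p m \<in> A i}"

definition monomial_action :: "('g, 'm) monoid_scheme \<Rightarrow> 'g \<Rightarrow> ('g \<Rightarrow>\<^sub>0 nat) \<Rightarrow> ('g \<Rightarrow>\<^sub>0 nat)" where
  "monomial_action G g m =
     (\<Sum>h \<in> Poly_Mapping.keys m. Poly_Mapping.single (g \<otimes>\<^bsub>G\<^esub> h) (Poly_Mapping.lookup m h))"

definition poly_action ::
  "('g, 'm) monoid_scheme \<Rightarrow> ('g \<Rightarrow> 'a :: comm_monoid_add \<Rightarrow> 'a) \<Rightarrow> 'g \<Rightarrow> ('g, 'a) mpoly \<Rightarrow> ('g, 'a) mpoly"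
  where
  "poly_action G \<phi> g p = (\<Sum>m \<in> Poly_Mapping.keys p.
     Poly_Mapping.single (monomial_action G g m) (\<phi> g (Poly_Mapping.lookup p m)))"

definition beta_invariants ::
  "'g set \<Rightarrow> (nat \<Rightarrow> 'a :: {comm_ring, comm_monoid_mult} set) \<Rightarrow> ('g \<Rightarrow> 'a \<Rightarrow> 'a) \<Rightarrow> enat" where
  "beta_invariants K A \<phi> = beta 1 (invariants K \<phi> UNIV) (\<lambda>d. invariants K \<phi> (A d))"

text \<open>
  \<open>\<beta>(A(H)\<^sup>H)\<close>, for a subgroup \<open>H\<close> of \<open>G\<close>; the variables are indexed by the elements of \<open>H\<close>.
\<close>

definition beta_poly_invariants ::
  "('g, 'm) monoid_scheme \<Rightarrow> 'g set \<Rightarrow> (nat \<Rightarrow> 'a :: {comm_ring, comm_monoid_mult} set) \<Rightarrow>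
     ('g \<Rightarrow> 'a \<Rightarrow> 'a) \<Rightarrow> enat" where
  "beta_poly_invariants G H A \<phi> =
     beta poly_one
       (invariants H (poly_action G \<phi>) (polys H))
       (\<lambda>d. invariants H (poly_action G \<phi>) (poly_component A H d))"

end

theory Submission
  imports Defs
begin

text \<open>
  Setting all variables to \<open>0\<close> is an \<open>H\<close>-equivariant graded retraction \<open>A(H) \<rightarrow> A\<close>, so generators of
  \<open>A(H)\<^sup>H\<close> of degree at most \<open>b\<close> give generators of \<open>A\<^sup>H\<close> of degree at most \<open>b\<close>.

  Let \<open>n = [G:H]\<close> and choose \<open>g\<^sub>1, \<dots>, g\<^sub>n \<in> G\<close> such that each \<open>h \<in> G\<close> has some \<open>h g\<^sub>i \<in> H\<close>. For
  \<open>f\<^sub>1, \<dots>, f\<^sub>n \<in> A\<^sup>H\<close> the product of the \<open>f\<^sub>i - h g\<^sub>i f\<^sub>i\<close> then vanishes for every \<open>h \<in> G\<close> (Benson's argument).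
  Expanding it and summing over \<open>h\<close> writes \<open>|G| f\<^sub>1 \<cdots> f\<^sub>n\<close> as a combination of proper subproducts whose
  coefficients are transfers of elements of degree at most \<open>n b\<close>. By induction on the number of
  factors, the transfer of every product of elements of \<open>A\<^sup>H\<close> of degree at most \<open>b\<close> lies in the
  subring generated by invariants of degree at most \<open>n b\<close>; and the transfer maps \<open>A\<^sup>H\<close> onto \<open>A\<^sup>G\<close>.
\<close>

section \<open>Product expansion and inverses in commutative rings\<close>

lemma prod_add_Pow:
  fixes f g :: "'i \<Rightarrow> 'a :: {comm_ring, comm_monoid_mult}"
  assumes "finite I"
  shows "(\<Prod>i\<in>I. f i + g i) = (\<Sum>S\<in>Pow I. prod f (I - S) * prod g S)"
  using assms
proof (induction I)
  case empty
  then show ?case by simp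
next
  case (insert x I)
  \<comment> \<open>Subsets of \<open>insert x I\<close> are the subsets of \<open>I\<close>, which
    receive the factor \<open>f x\<close>, and their images under \<open>insert x\<close>, which
    receive \<open>g x\<close>.\<close>
  have disj: "Pow I \<inter> insert x ` Pow I = {}"
    using insert.hyps by auto
  have inj: "inj_on (insert x) (Pow I)"
    using insert.hyps by (auto simp: inj_on_def)
  have f: "prod f (insert x I - S) * prod g S = f x * (prod f (I - S) * prod g S)"
    if "S \<in> Pow I" for S
  proof -
    have "insert x I - S = insert x (I - S)"
      using that insert.hyps by auto
    then show ?thesis using insert.hyps by (simp add: mult.assoc)
  qed
  have g: "prod f (insert x I - insert x S) * prod g (insert x S) = g x * (prod f (I - S) * prod g S)"
    if "S \<in> Pow I" for S
  proof -
    have "insert x I - insert x S = I - S" "x \<notin> S" "finite S"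
      using that insert.hyps finite_subset by auto
    then show ?thesis by (simp add: mult.left_commute)
  qed
  have "(\<Sum>S\<in>Pow (insert x I). prod f (insert x I - S) * prod g S) =
      (\<Sum>S\<in>Pow I. f x * (prod f (I - S) * prod g S)) + (\<Sum>S\<in>Pow I. g x * (prod f (I - S) * prod g S))"
    unfolding Pow_insert
    by (subst sum.union_disjoint)
       (use insert.hyps disj f g in \<open>auto simp: sum.reindex[OF inj] intro!: arg_cong2[of _ _ _ _ "(+)"] sum.cong\<close>)
  also have "\<dots> = (f x + g x) * (\<Prod>i\<in>I. f i + g i)"
    using insert.IH by (simp add: sum_distrib_left distrib_right sum.distrib)
  finally show ?case using insert.hyps by simp
qed

lemma mult_inverse_unique:
  fixes c u v :: "'a :: comm_monoid_mult"
  assumes "c * u = 1" "c * v = 1"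
  shows "u = v"
proof -
  have "u = (c * v) * u" using assms(2) by simp
  also have "\<dots> = (c * u) * v" by (simp add: ac_simps)
  finally show ?thesis using assms(1) by simp
qed

section \<open>Generated subrings and the number \<open>beta\<close>\<close>

lemma subring_generated_zero: "0 \<in> subring_generated e S"
  using subring_generated.add[OF subring_generated.one subring_generated.uminus[OF subring_generated.one]]
  by simp

lemma subring_generated_sum:
  "(\<And>i. i \<in> I \<Longrightarrow> f i \<in> subring_generated e S) \<Longrightarrow> sum f I \<in> subring_generated e S"
  by (induction I rule: infinite_finite_induct)
     (auto intro: subring_generated_zero subring_generated.add)

text \<open>The transfer is additive but not multiplicative, so elements of a generated subring are
  needed in this explicit form. Such sums are closed under multiplication by concatenating factor
  lists, and under negation because \<open>- 1\<close> lies in \<open>S\<close>.\<close>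

lemma subring_generated_sum_of_products:
  fixes S :: "'a :: {comm_ring, comm_monoid_mult} set"
  assumes "x \<in> subring_generated 1 S" and one: "1 \<in> S" and uminus: "\<And>a. a \<in> S \<Longrightarrow> - a \<in> S"
  obtains xss where "\<And>xs. xs \<in> set xss \<Longrightarrow> set xs \<subseteq> S" "x = sum_list (map prod_list xss)"
proof -
  have "\<exists>xss. (\<forall>xs\<in>set xss. set xs \<subseteq> S) \<and> x = sum_list (map prod_list xss)"
    using assms(1)
  proof induction
    case one
    then show ?case by (intro exI[of _ "[[]]"]) simp
  next
    case (incl a)
    then show ?case by (intro exI[of _ "[[a]]"]) simp
  next
    case (uminus a)
    then obtain xss where xss: "\<forall>xs\<in>set xss. set xs \<subseteq> S" "a = sum_list (map prod_list xss)"
      by blast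
    define yss where "yss = map (\<lambda>xs. - 1 # xs) xss"
    have "sum_list (map prod_list yss) = - a"
      unfolding xss(2) yss_def by (induction xss) auto
    moreover have "\<forall>ys\<in>set yss. set ys \<subseteq> S"
      using xss(1) one assms(3) by (auto simp: yss_def)
    ultimately show ?case by metis
  next
    case (add a b)
    then obtain xss yss where "\<forall>xs\<in>set xss. set xs \<subseteq> S" "a = sum_list (map prod_list xss)"
      "\<forall>xs\<in>set yss. set xs \<subseteq> S" "b = sum_list (map prod_list yss)"
      by blast
    then show ?case by (intro exI[of _ "xss @ yss"]) auto
  next
    case (mult a b)
    then obtain xss yss where xss: "\<forall>xs\<in>set xss. set xs \<subseteq> S" "a = sum_list (map prod_list xss)"
      and yss: "\<forall>xs\<in>set yss. set xs \<subseteq> S" "b = sum_list (map prod_list yss)"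
      by blast
    define zss where "zss = concat (map (\<lambda>xs. map ((@) xs) yss) xss)"
    have "sum_list (map prod_list (map ((@) xs) yss)) = prod_list xs * b" for xs
      unfolding yss(2) by (induction yss) (auto simp: distrib_left)
    then have "sum_list (map prod_list zss) = a * b"
      unfolding xss(2) zss_def by (induction xss) (auto simp: distrib_right)
    moreover have "\<forall>zs\<in>set zss. set zs \<subseteq> S"
      using xss(1) yss(1) unfolding zss_def by auto
    ultimately show ?case by metis
  qed
  then show thesis using that by blast
qed

lemma beta_le: "subring_generated e (degree_upto R n) = C \<Longrightarrow> beta e C R \<le> enat n"
  unfolding beta_def by (intro Inf_lower) blast

text \<open>\<open>enat\<close> is well-ordered, so a nonempty set contains its infimum; a finite
  value excludes the empty set, whose infimum is infinite.\<close>

lemma beta_attained: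
  assumes "beta e C R = enat n"
  shows "subring_generated e (degree_upto R n) = C"
proof -
  let ?X = "{enat n | n. subring_generated e (degree_upto R n) = C}"
  have Inf: "Inf ?X = enat n"
    using assms unfolding beta_def .
  have "?X \<noteq> {}"
  proof
    assume "?X = {}"
    then show False using Inf by (simp add: Inf_enat_def)
  qed
  then obtain x where "x \<in> ?X" by fast
  then have "Inf ?X \<in> ?X" by (rule wellorder_InfI)
  then show ?thesis unfolding Inf by simp
qed

section \<open>Elements of bounded degree\<close>

lemma degree_upto_add:
  assumes "\<And>d a b. a \<in> R d \<Longrightarrow> b \<in> R d \<Longrightarrow> a + b \<in> R d"
    and "x \<in> degree_upto R n" "y \<in> degree_upto R n"
  shows "x + y \<in> degree_upto R n"
proof -
  obtain f g where "x = (\<Sum>d\<le>n. f d)" "\<forall>d\<le>n. f d \<in> R d" "y = (\<Sum>d\<le>n. g d)" "\<forall>d\<le>n. g d \<in> R d"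
    using assms(2,3) unfolding degree_upto_def by auto
  then show ?thesis
    unfolding degree_upto_def using assms(1)
    by (auto intro!: exI[of _ "\<lambda>d. f d + g d"] simp: sum.distrib)
qed

lemma degree_upto_homogeneous:
  assumes "\<And>d. 0 \<in> R d" "a \<in> R i" "i \<le> n"
  shows "a \<in> degree_upto R n"
  unfolding degree_upto_def using assms
  by (auto intro!: exI[of _ "\<lambda>d. if d = i then a else 0"])

lemma degree_upto_sum:
  assumes "\<And>d. 0 \<in> R d" "\<And>d a b. a \<in> R d \<Longrightarrow> b \<in> R d \<Longrightarrow> a + b \<in> R d"
    and "\<And>i. i \<in> I \<Longrightarrow> f i \<in> degree_upto R n"
  shows "sum f I \<in> degree_upto R n"
  using assms(3)
  by (induction I rule: infinite_finite_induct)
     (auto intro: degree_upto_homogeneous[of R 0 0] degree_upto_add assms(1,2))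

text \<open>Serves for group elements, negation, the transfer and the constant coefficient of a
  polynomial.\<close>

lemma degree_upto_image:
  assumes "\<And>d a. a \<in> R d \<Longrightarrow> f a \<in> R' d" "f 0 = 0" "\<And>a b. f (a + b) = f a + f b"
    and "x \<in> degree_upto R n"
  shows "f x \<in> degree_upto R' n"
proof -
  obtain g where g: "x = (\<Sum>d\<le>n. g d)" "\<forall>d\<le>n. g d \<in> R d"
    using assms(4) unfolding degree_upto_def by auto
  have "f (\<Sum>d\<in>D. g d) = (\<Sum>d\<in>D. f (g d))" for D :: "nat set"
    by (induction D rule: infinite_finite_induct) (auto simp: assms(2,3))
  then show ?thesis
    using g assms(1) unfolding degree_upto_def by (auto intro!: exI[of _ "\<lambda>d. f (g d)"])
qed

lemma degree_upto_mono_components: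
  "(\<And>d. R d \<subseteq> R' d) \<Longrightarrow> degree_upto R n \<subseteq> degree_upto R' n"
  unfolding degree_upto_def by blast

context graded_comm_ring
begin

lemma degree_upto_mono:
  assumes "x \<in> degree_upto A m" "m \<le> n"
  shows "x \<in> degree_upto A n"
proof -
  obtain f where f: "x = (\<Sum>d\<le>m. f d)" "\<forall>d\<le>m. f d \<in> A d"
    using assms(1) unfolding degree_upto_def by auto
  show ?thesis
    unfolding f(1) using f(2) assms(2)
    by (intro degree_upto_sum) (auto intro: degree_upto_homogeneous zero_mem add_mem)
qed

lemma degree_upto_mult:
  assumes "x \<in> degree_upto A m" "y \<in> degree_upto A n"
  shows "x * y \<in> degree_upto A (m + n)"
proof -
  obtain f g where f: "x = (\<Sum>d\<le>m. f d)" "\<forall>d\<le>m. f d \<in> A d"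
    and g: "y = (\<Sum>d\<le>n. g d)" "\<forall>d\<le>n. g d \<in> A d"
    using assms unfolding degree_upto_def by auto
  have "f i * g j \<in> degree_upto A (m + n)" if "i \<le> m" "j \<le> n" for i j
    using that f(2) g(2)
    by (intro degree_upto_homogeneous[of A _ "i + j"]) (auto intro: zero_mem mult_mem)
  then show ?thesis
    unfolding f(1) g(1) sum_product
    by (intro degree_upto_sum) (auto intro: zero_mem add_mem)
qed

lemma degree_upto_prod:
  assumes "finite I" "\<And>i. i \<in> I \<Longrightarrow> f i \<in> degree_upto A n"
  shows "prod f I \<in> degree_upto A (card I * n)"
  using assms
  by (induction I)
     (auto intro: degree_upto_homogeneous zero_mem one_mem degree_upto_mult)

text \<open>Multiplication by \<open>c\<close> acts componentwise, so comparing degree 0 components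
  in \<open>c * u = 1\<close> shows that the degree 0 component of \<open>u\<close> is an inverse of
  \<open>c\<close> as well, hence equals \<open>u\<close>. Meant for \<open>c\<close> = |G|.\<close>

lemma inverse_mem_degree_0:
  assumes "c \<in> A 0" "c * u = 1"
  shows "u \<in> A 0"
proof -
  obtain f where f: "\<And>d. f d \<in> A d" "finite {d. f d \<noteq> 0}" "u = (\<Sum>d | f d \<noteq> 0. f d)"
    using direct_sum[of u] by blast
  let ?P = "\<lambda>f. (\<forall>d. f d \<in> A d) \<and> finite {d. f d \<noteq> 0} \<and> 1 = (\<Sum>d | f d \<noteq> 0. f d)"
  \<comment> \<open>Multiplication by \<open>c\<close> may kill components, so the support can
    shrink.\<close>
  have supp: "{d. c * f d \<noteq> 0} \<subseteq> {d. f d \<noteq> 0}" by auto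
  have "1 = (\<Sum>d | f d \<noteq> 0. c * f d)"
    using assms(2) f(3) by (simp add: sum_distrib_left)
  also have "\<dots> = (\<Sum>d | c * f d \<noteq> 0. c * f d)"
    using f(2) supp by (intro sum.mono_neutral_right) auto
  finally have P1: "?P (\<lambda>d. c * f d)"
    using f(1,2) supp mult_mem[OF assms(1) f(1)] by (auto intro: finite_subset)
  have P2: "?P (\<lambda>d. if d = 0 then 1 else 0)"
  \<comment> \<open>In the zero ring this family has empty support instead of
    \<open>{0}\<close>.\<close>
  proof (cases "(1::'a) = 0")
    case True
    then show ?thesis using zero_mem by simp
  next
    case False
    then have "{d. (if d = (0::nat) then (1::'a) else 0) \<noteq> 0} = {0}" by auto
    then show ?thesis using zero_mem one_mem by auto
  qed
  have "\<exists>\<^sub>\<le>\<^sub>1f. ?P f"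
    using direct_sum[of 1] unfolding ex1_iff_ex_Uniq by (rule conjunct2)
  then have "(\<lambda>d. c * f d) = (\<lambda>d. if d = 0 then 1 else 0)"
    by (rule Uniq_D[where P = ?P, OF _ P1 P2])
  from fun_cong[OF this, of 0] have "c * f 0 = 1" by simp
  then have "u = f 0"
    by (rule mult_inverse_unique[OF assms(2)])
  then show ?thesis using f(1) by simp
qed

end

section \<open>Group actions, invariants and the transfer\<close>

context graded_ring_action
begin

lemma action_zero: "g \<in> carrier G \<Longrightarrow> \<phi> g 0 = 0"
  using action_add[of g 0 0] by simp

lemma action_uminus: "g \<in> carrier G \<Longrightarrow> \<phi> g (- a) = - \<phi> g a"
  using action_add[of g a "- a"] by (simp add: action_zero eq_neg_iff_add_eq_0 add.commute)

lemma action_sum: "g \<in> carrier G \<Longrightarrow> \<phi> g (sum f I) = (\<Sum>i\<in>I. \<phi> g (f i))"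
  by (induction I rule: infinite_finite_induct) (auto simp: action_zero action_add)

lemma action_prod: "g \<in> carrier G \<Longrightarrow> \<phi> g (prod f I) = (\<Prod>i\<in>I. \<phi> g (f i))"
  by (induction I rule: infinite_finite_induct) (auto simp: action_one action_mult)

lemma action_comp:
  "\<lbrakk>g \<in> carrier G; h \<in> carrier G\<rbrakk> \<Longrightarrow> \<phi> g (\<phi> h a) = \<phi> (g \<otimes>\<^bsub>G\<^esub> h) a"
  using composition_rule by simp

lemma action_degree_upto:
  "\<lbrakk>g \<in> carrier G; x \<in> degree_upto A n\<rbrakk> \<Longrightarrow> \<phi> g x \<in> degree_upto A n"
  by (rule degree_upto_image[of A "\<phi> g" A]) (auto simp: action_degree action_zero action_add)

lemma subring_generated_invariants:
  assumes "K \<subseteq> carrier G" "S \<subseteq> invariants K \<phi> UNIV"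
  shows "subring_generated 1 S \<subseteq> invariants K \<phi> UNIV"
proof
  fix x assume "x \<in> subring_generated 1 S"
  then show "x \<in> invariants K \<phi> UNIV"
    by induction
       (use assms in \<open>auto simp: invariants_def action_one action_uminus action_add action_mult subset_iff\<close>)
qed

lemma degree_upto_invariants:
  assumes "K \<subseteq> carrier G"
  shows "degree_upto (\<lambda>d. invariants K \<phi> (A d)) n \<subseteq> invariants K \<phi> UNIV"
  using assms by (auto simp: degree_upto_def invariants_def action_sum subset_iff intro!: sum.cong)

text \<open>Applying \<open>\<phi> g\<close> to \<open>c * u = 1\<close> gives a second inverse
  \<open>\<phi> g u\<close> of \<open>c\<close>; inverses are unique.\<close>

lemma inverse_invariant:
  assumes "c \<in> invariants (carrier G) \<phi> UNIV" and u: "c * u = 1"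
  shows "u \<in> invariants (carrier G) \<phi> UNIV"
proof -
  have "\<phi> g u = u" if g: "g \<in> carrier G" for g
  proof -
    have "c * \<phi> g u = 1"
      using assms(1) arg_cong[OF u, of "\<phi> g"] g by (simp add: invariants_def action_mult action_one)
    then show ?thesis by (rule mult_inverse_unique[OF _ u])
  qed
  then show ?thesis by (simp add: invariants_def)
qed

text \<open>The Reynolds operator without division by |G|. Its value at 1 is |G| in the ring, so
  invertibility of |G| takes the form \<open>transfer 1 * u = 1\<close>.\<close>

definition transfer :: "'a \<Rightarrow> 'a" where
  "transfer a = (\<Sum>h\<in>carrier G. \<phi> h a)"

lemma transfer_zero: "transfer 0 = 0"
  by (simp add: transfer_def action_zero)

lemma transfer_add: "transfer (a + b) = transfer a + transfer b"
  by (simp add: transfer_def action_add sum.distrib)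

lemma transfer_sum: "transfer (sum f I) = (\<Sum>i\<in>I. transfer (f i))"
  by (induction I rule: infinite_finite_induct) (auto simp: transfer_zero transfer_add)

lemma transfer_one: "transfer 1 = (\<Sum>g\<in>carrier G. 1)"
  by (simp add: transfer_def action_one)

lemma transfer_mult_invariant:
  assumes "b \<in> invariants (carrier G) \<phi> UNIV"
  shows "transfer (a * b) = transfer a * b"
  using assms by (auto simp: transfer_def invariants_def action_mult sum_distrib_right intro!: sum.cong)

lemma action_transfer:
  assumes g: "g \<in> carrier G"
  shows "\<phi> g (transfer a) = transfer a"
proof -
  interpret group G using group_hom group_hom.axioms(1) by blast
  have "\<phi> g (transfer a) = (\<Sum>h\<in>carrier G. \<phi> (g \<otimes>\<^bsub>G\<^esub> h) a)"
    using g by (simp add: transfer_def action_sum action_comp)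
  also have "\<dots> = transfer a"
    unfolding transfer_def
    by (rule sum.reindex_bij_witness[of _ "\<lambda>h. inv\<^bsub>G\<^esub> g \<otimes>\<^bsub>G\<^esub> h" "\<lambda>h. g \<otimes>\<^bsub>G\<^esub> h"])
       (use g in \<open>auto simp: m_assoc[symmetric]\<close>)
  finally show ?thesis .
qed

lemma transfer_invariant: "transfer a \<in> invariants (carrier G) \<phi> UNIV"
  by (simp add: invariants_def action_transfer)

lemma transfer_degree:
  assumes "a \<in> A d"
  shows "transfer a \<in> invariants (carrier G) \<phi> (A d)"
proof -
  have "sum f I \<in> A d" if "\<And>i. i \<in> I \<Longrightarrow> f i \<in> A d" for f and I :: "'g set"
    using that by (induction I rule: infinite_finite_induct) (auto intro: zero_mem add_mem)
  then have "transfer a \<in> A d"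
    using assms action_degree by (simp add: transfer_def)
  then show ?thesis by (simp add: invariants_def action_transfer)
qed

lemma transfer_degree_upto:
  "x \<in> degree_upto A n \<Longrightarrow> transfer x \<in> degree_upto (\<lambda>d. invariants (carrier G) \<phi> (A d)) n"
  by (rule degree_upto_image[of A]) (auto simp: transfer_degree transfer_zero transfer_add)

section \<open>Benson's argument\<close>

lemma transfer_prod_expansion:
  assumes fin: "finite I" and J: "J \<subseteq> I"
    and F: "\<And>i. i \<in> J \<Longrightarrow> F i \<in> invariants H \<phi> UNIV"
    and \<gamma>: "\<And>i. i \<in> J \<Longrightarrow> \<gamma> i \<in> carrier G"
    and cover: "\<And>h. h \<in> carrier G \<Longrightarrow> \<exists>i\<in>J. h \<otimes>\<^bsub>G\<^esub> \<gamma> i \<in> H"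
  shows "transfer 1 * transfer (prod F I) =
    - (\<Sum>S\<in>Pow J - {{}}. transfer (prod F (I - S)) * transfer (\<Prod>i\<in>S. \<phi> (\<gamma> i) (- F i)))"
proof -
  \<comment> \<open>The signs are absorbed into \<open>Q\<close>, so that each factor is a sum and
    \<open>prod_add_Pow\<close> applies.\<close>
  define Q where "Q S = (\<Prod>i\<in>S. \<phi> (\<gamma> i) (- F i))" for S
  have finJ: "finite J" using fin J finite_subset by blast
  have "(\<Sum>S\<in>Pow J. prod F (J - S) * \<phi> h (Q S)) = 0" if h: "h \<in> carrier G" for h
  proof -
    \<comment> \<open>The group element \<open>h \<otimes> \<gamma> i\<close> lies in
      \<open>H\<close> and fixes \<open>F i\<close>, so the factor with index \<open>i\<close>
      vanishes.\<close>
    obtain i where i: "i \<in> J" "h \<otimes>\<^bsub>G\<^esub> \<gamma> i \<in> H" using cover[OF h] by blast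
    have "\<phi> h (\<phi> (\<gamma> i) (- F i)) = - \<phi> (h \<otimes>\<^bsub>G\<^esub> \<gamma> i) (F i)"
      using h \<gamma>[OF i(1)] by (simp add: action_uminus action_comp)
    also have "\<dots> = - F i"
      using F[OF i(1)] i(2) by (simp add: invariants_def)
    finally have vanish: "F i + \<phi> h (\<phi> (\<gamma> i) (- F i)) = 0" by simp
    have "(\<Sum>S\<in>Pow J. prod F (J - S) * \<phi> h (Q S)) = (\<Prod>i\<in>J. F i + \<phi> h (\<phi> (\<gamma> i) (- F i)))"
      unfolding Q_def using h by (simp add: prod_add_Pow[OF finJ] action_prod)
    also have "\<dots> = 0"
      using vanish by (simp add: prod.remove[OF finJ i(1)])
    finally show ?thesis .
  qed
  then have "0 = (\<Sum>h\<in>carrier G. \<Sum>S\<in>Pow J. prod F (J - S) * \<phi> h (Q S))"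
    by simp
  also have "\<dots> = (\<Sum>S\<in>Pow J. prod F (J - S) * transfer (Q S))"
    by (subst sum.swap) (simp add: transfer_def sum_distrib_left)
  \<comment> \<open>The factors outside \<open>J\<close> are restored and the transfer is applied a
    second time; the inner transfers are invariant and therefore come out as factors.\<close>
  finally have "0 = transfer (prod F (I - J) * (\<Sum>S\<in>Pow J. prod F (J - S) * transfer (Q S)))"
    by (metis mult_zero_right transfer_zero)
  also have "\<dots> = (\<Sum>S\<in>Pow J. transfer (prod F (I - S) * transfer (Q S)))"
  proof -
    have "prod F (I - S) = prod F (I - J) * prod F (J - S)" if "S \<in> Pow J" for S
    proof -
      have "I - S = (I - J) \<union> (J - S)" using that J by auto
      moreover have "(I - J) \<inter> (J - S) = {}" by auto
      ultimately show ?thesis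
        using prod.union_disjoint[OF finite_Diff[OF fin] finite_Diff[OF finJ]] by simp
    qed
    then have "prod F (I - J) * (prod F (J - S) * transfer (Q S)) = prod F (I - S) * transfer (Q S)"
      if "S \<in> Pow J" for S
      using that by (simp only: mult.assoc)
    then show ?thesis
      unfolding transfer_sum sum_distrib_left by (intro sum.cong refl arg_cong[of _ _ transfer])
  qed
  also have "\<dots> = (\<Sum>S\<in>Pow J. transfer (prod F (I - S)) * transfer (Q S))"
    by (simp add: transfer_mult_invariant transfer_invariant)
  \<comment> \<open>The term of the empty set carries the full product, since
    \<open>Q {} = 1\<close>.\<close>
  also have "\<dots> = transfer (prod F I) * transfer 1
      + (\<Sum>S\<in>Pow J - {{}}. transfer (prod F (I - S)) * transfer (Q S))"
    using finJ by (subst sum.remove[of _ "{}"]) (auto simp: Q_def)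
  finally show ?thesis
    unfolding eq_neg_iff_add_eq_0 Q_def by (simp only: mult.commute[of "transfer 1"])
qed

text \<open>Take inverses of representatives \<open>\<rho> i\<close> of the right cosets: if
  \<open>h\<close> lies in the coset of \<open>\<rho> i\<close>, then \<open>h\<close> times the
  inverse of \<open>\<rho> i\<close> lies in \<open>H\<close>. The index set is arbitrary because
  \<open>J\<close> will be a set of positions in a product.\<close>

lemma coset_representatives:
  assumes "finite (carrier G)" "subgroup H G"
    and "finite J" "card J = card (rcosets\<^bsub>G\<^esub> H)"
  obtains \<gamma> where "\<And>i. i \<in> J \<Longrightarrow> \<gamma> i \<in> carrier G"
    "\<And>h. h \<in> carrier G \<Longrightarrow> \<exists>i\<in>J. h \<otimes>\<^bsub>G\<^esub> \<gamma> i \<in> H"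
proof -
  interpret group G using group_hom group_hom.axioms(1) by blast
  have "finite (rcosets\<^bsub>G\<^esub> H)"
    using assms(1) by (simp add: RCOSETS_def)
  then obtain \<sigma> where \<sigma>: "bij_betw \<sigma> J (rcosets\<^bsub>G\<^esub> H)"
    using finite_same_card_bij[OF assms(3) _ assms(4)] by blast
  have "\<exists>x\<in>carrier G. \<sigma> i = H #>\<^bsub>G\<^esub> x" if "i \<in> J" for i
    using bij_betwE[OF \<sigma>] that unfolding RCOSETS_def by blast
  then obtain \<rho> where \<rho>: "\<And>i. i \<in> J \<Longrightarrow> \<rho> i \<in> carrier G" "\<And>i. i \<in> J \<Longrightarrow> \<sigma> i = H #>\<^bsub>G\<^esub> \<rho> i"
    by metis
  have "\<exists>i\<in>J. h \<otimes>\<^bsub>G\<^esub> inv\<^bsub>G\<^esub> (\<rho> i) \<in> H" if h: "h \<in> carrier G" for h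
  proof -
    have "H #>\<^bsub>G\<^esub> h \<in> \<sigma> ` J"
      using \<sigma> h unfolding bij_betw_def RCOSETS_def by blast
    then obtain i where i: "i \<in> J" "H #>\<^bsub>G\<^esub> h = H #>\<^bsub>G\<^esub> \<rho> i"
      using \<rho>(2) by auto
    have "h \<in> H #>\<^bsub>G\<^esub> \<rho> i"
      using rcos_self[OF h assms(2)] i(2) by simp
    then obtain w where w: "w \<in> H" "h = w \<otimes>\<^bsub>G\<^esub> \<rho> i"
      unfolding r_coset_def by blast
    have "w \<in> carrier G" using w(1) subgroup.subset[OF assms(2)] by blast
    then have "h \<otimes>\<^bsub>G\<^esub> inv\<^bsub>G\<^esub> (\<rho> i) = w"
      using w(2) \<rho>(1)[OF i(1)] by (simp add: m_assoc)
    then show ?thesis using w(1) i(1) by blast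
  qed
  then show thesis
    using that[of "\<lambda>i. inv\<^bsub>G\<^esub> (\<rho> i)"] \<rho>(1) by simp
qed

text \<open>A product of at most \<open>n\<close> factors has degree at most \<open>n * b\<close>,
  so its transfer is itself a generator. A longer product is expanded over \<open>n\<close> of its
  indices, which leaves shorter products, covered by strong induction, and transfers of products of
  at most \<open>n\<close> elements of degree at most \<open>b\<close>.\<close>

lemma transfer_prod_mem:
  fixes F :: "nat \<Rightarrow> 'a" and H :: "'g set"
  defines "n \<equiv> card (rcosets\<^bsub>G\<^esub> H)"
  assumes "finite (carrier G)" "subgroup H G" and u: "transfer 1 * u = 1"
    and "finite I" and "\<And>i. i \<in> I \<Longrightarrow> F i \<in> degree_upto (\<lambda>d. invariants H \<phi> (A d)) b"
  shows "transfer (prod F I)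
    \<in> subring_generated 1 (degree_upto (\<lambda>d. invariants (carrier G) \<phi> (A d)) (n * b))"
    (is "_ \<in> ?T")
  using assms(5,6)
proof (induction "card I" arbitrary: I rule: less_induct)
  case less
  have HG: "H \<subseteq> carrier G" using subgroup.subset[OF assms(3)] .
  have deg: "F i \<in> degree_upto A b" if "i \<in> I" for i
    using less.prems(2)[OF that] degree_upto_mono_components[of "\<lambda>d. invariants H \<phi> (A d)" A]
    by (auto simp: invariants_def)
  have transfer_mem: "transfer x \<in> ?T" if "x \<in> degree_upto A (k * b)" "k \<le> n" for x k
    using that
    by (intro subring_generated.incl transfer_degree_upto) (auto intro: degree_upto_mono mult_le_mono1)
  show ?case
  proof (cases "card I \<le> n")
    case True
    then show ?thesis
      using transfer_mem[OF degree_upto_prod[OF less.prems(1)]] deg by blast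
  next
    case False
    then obtain J where J: "J \<subseteq> I" "card J = n"
      using obtain_subset_with_card_n[of n I] by auto
    have finJ: "finite J" using J(1) less.prems(1) finite_subset by blast
    obtain \<gamma> where \<gamma>: "\<And>i. i \<in> J \<Longrightarrow> \<gamma> i \<in> carrier G"
      "\<And>h. h \<in> carrier G \<Longrightarrow> \<exists>i\<in>J. h \<otimes>\<^bsub>G\<^esub> \<gamma> i \<in> H"
      using coset_representatives[OF assms(2,3) finJ] J(2) unfolding n_def by blast
    have F: "F i \<in> invariants H \<phi> UNIV" if "i \<in> J" for i
      using that J(1) less.prems(2) degree_upto_invariants[OF HG] by blast
    have "transfer (prod F (I - S)) \<in> ?T \<and> transfer (\<Prod>i\<in>S. \<phi> (\<gamma> i) (- F i)) \<in> ?T"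
      if S: "S \<in> Pow J - {{}}" for S
    proof
      \<comment> \<open>\<open>S\<close> is nonempty, so the remaining product is strictly
        shorter.\<close>
      have "I - S \<subset> I" using S J(1) by auto
      then show "transfer (prod F (I - S)) \<in> ?T"
        using less.prems by (intro less.hyps) (auto intro: psubset_card_mono)
      have S': "S \<subseteq> J" using S by simp
      have "\<phi> (\<gamma> i) (- F i) \<in> degree_upto A b" if "i \<in> S" for i
        using that S J(1) deg \<gamma>(1)
        by (intro action_degree_upto degree_upto_image[of A uminus A]) (auto intro: uminus_mem)
      then have "(\<Prod>i\<in>S. \<phi> (\<gamma> i) (- F i)) \<in> degree_upto A (card S * b)"
        by (intro degree_upto_prod finite_subset[OF S' finJ])
      moreover have "card S \<le> n"
        using card_mono[OF finJ S'] J(2) by simp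
      ultimately show "transfer (\<Prod>i\<in>S. \<phi> (\<gamma> i) (- F i)) \<in> ?T"
        by (rule transfer_mem)
    qed
    then have "- (\<Sum>S\<in>Pow J - {{}}. transfer (prod F (I - S)) *
        transfer (\<Prod>i\<in>S. \<phi> (\<gamma> i) (- F i))) \<in> ?T"
      by (intro subring_generated.uminus subring_generated_sum subring_generated.mult) blast+
    then have "transfer 1 * transfer (prod F I) \<in> ?T"
      using transfer_prod_expansion[OF less.prems(1) J(1) F \<gamma>] by (simp only:)
    \<comment> \<open>The inverse of |G| is an invariant of degree 0, hence a generator for every
      degree bound; this allows division by |G| inside the subring.\<close>
    moreover have "u \<in> ?T"
    proof -
      have "u \<in> A 0"
        using inverse_mem_degree_0[OF _ u] transfer_degree[OF one_mem] by (simp add: invariants_def)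
      then have "u \<in> invariants (carrier G) \<phi> (A 0)"
        using inverse_invariant[OF transfer_invariant u] by (simp add: invariants_def)
      then show ?thesis
        by (intro subring_generated.incl degree_upto_homogeneous[of _ _ 0])
           (auto simp: invariants_def zero_mem action_zero)
    qed
    ultimately have "u * (transfer 1 * transfer (prod F I)) \<in> ?T"
      by (rule subring_generated.mult[rotated])
    moreover have "u * (transfer 1 * transfer (prod F I)) = transfer (prod F I)"
      using u by (simp only: mult.assoc[symmetric] mult.commute[of u] mult_1)
    ultimately show ?thesis by simp
  qed
qed

text \<open>A \<open>G\<close>-invariant \<open>a\<close> is the transfer of \<open>u * a\<close>,
  which is in particular \<open>H\<close>-invariant and hence a sum of products of generators of
  degree at most \<open>b\<close>. The transfer is then treated product by product.\<close>

lemma beta_invariants_le_index: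
  assumes "finite (carrier G)" "subgroup H G" and u: "transfer 1 * u = 1"
    and gen: "invariants H \<phi> UNIV \<subseteq> subring_generated 1 (degree_upto (\<lambda>d. invariants H \<phi> (A d)) b)"
  shows "beta_invariants (carrier G) A \<phi> \<le> enat (card (rcosets\<^bsub>G\<^esub> H) * b)"
  unfolding beta_invariants_def
proof (rule beta_le, rule antisym)
  let ?S = "degree_upto (\<lambda>d. invariants H \<phi> (A d)) b"
  let ?T = "subring_generated 1
    (degree_upto (\<lambda>d. invariants (carrier G) \<phi> (A d)) (card (rcosets\<^bsub>G\<^esub> H) * b))"
  show "?T \<subseteq> invariants (carrier G) \<phi> UNIV"
    by (intro subring_generated_invariants degree_upto_invariants) auto
  have HG: "H \<subseteq> carrier G" using subgroup.subset[OF assms(2)] .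
  have S: "1 \<in> ?S" "\<And>a. a \<in> ?S \<Longrightarrow> - a \<in> ?S"
  proof -
    show "1 \<in> ?S"
      using HG by (intro degree_upto_homogeneous[of _ _ 0])
        (auto simp: invariants_def zero_mem one_mem action_zero action_one subset_iff)
    show "- a \<in> ?S" if "a \<in> ?S" for a
      using that HG by (intro degree_upto_image[of "\<lambda>d. invariants H \<phi> (A d)" uminus])
        (auto simp: invariants_def uminus_mem action_uminus subset_iff)
  qed
  have transfer_mem: "transfer x \<in> ?T" if x: "x \<in> invariants H \<phi> UNIV" for x
  proof -
    obtain xss where xss: "\<And>xs. xs \<in> set xss \<Longrightarrow> set xs \<subseteq> ?S" "x = sum_list (map prod_list xss)"
      using subring_generated_sum_of_products[OF _ S, of x thesis] x gen by blast
    \<comment> \<open>Indexing by list positions keeps repeated factors apart.\<close>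
    have "transfer (prod_list xs) \<in> ?T" if "xs \<in> set xss" for xs
      unfolding prod.list_conv_set_nth
      using xss(1)[OF that] by (intro transfer_prod_mem[OF assms(1,2) u]) (auto simp: subset_iff)
    then show ?thesis
      unfolding xss(2)
      by (induction xss) (auto simp: transfer_zero transfer_add intro: subring_generated_zero subring_generated.add)
  qed
  show "invariants (carrier G) \<phi> UNIV \<subseteq> ?T"
  proof
    fix a assume a: "a \<in> invariants (carrier G) \<phi> UNIV"
    then have ua: "u * a \<in> invariants (carrier G) \<phi> UNIV"
      using inverse_invariant[OF transfer_invariant u] by (simp add: invariants_def action_mult)
    then have "transfer (u * a) \<in> ?T"
      using HG by (intro transfer_mem) (auto simp: invariants_def)
    moreover have "transfer (u * a) = a"
      using transfer_mult_invariant[OF ua, of 1] u by (simp add: mult.assoc[symmetric])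
    ultimately show "a \<in> ?T" by simp
  qed
qed

end

section \<open>The constant coefficient as an equivariant retraction\<close>

lemma lookup_mult_zero:
  fixes p q :: "('v, 'a :: comm_ring) mpoly"
  shows "Poly_Mapping.lookup (p * q) 0 = Poly_Mapping.lookup p 0 * Poly_Mapping.lookup q 0"
proof -
  \<comment> \<open>Exponents are natural numbers, so only the pair of constant monomials
    contributes to the constant coefficient of a product.\<close>
  have zero: "0 = l + m \<longleftrightarrow> l = 0 \<and> m = 0" for l m :: "'v \<Rightarrow>\<^sub>0 nat"
    by (auto simp: poly_mapping_eq_iff lookup_add fun_eq_iff)
  have "(\<Sum>m. Poly_Mapping.lookup q m when 0 = l + m) = (Poly_Mapping.lookup q 0 when l = 0)" for l :: "'v \<Rightarrow>\<^sub>0 nat"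
    by (cases "l = 0") (simp_all add: zero)
  then show ?thesis
    by (simp add: lookup_mult mult_when)
qed

lemma monomial_action_zero: "monomial_action G g 0 = 0"
  by (simp add: monomial_action_def)

text \<open>Natural exponents cannot cancel, even if several variables had the same image, so no
  nonconstant monomial becomes constant.\<close>

lemma monomial_action_eq_zero_iff: "monomial_action G g m = 0 \<longleftrightarrow> m = 0"
proof
  assume eq: "monomial_action G g m = 0"
  show "m = 0"
  proof (rule ccontr)
    assume "m \<noteq> 0"
    then obtain h where h: "h \<in> Poly_Mapping.keys m"
      by (meson ex_in_conv keys_eq_empty)
    have "Poly_Mapping.lookup m h \<le> (\<Sum>k\<in>Poly_Mapping.keys m.
        Poly_Mapping.lookup (Poly_Mapping.single (g \<otimes>\<^bsub>G\<^esub> k) (Poly_Mapping.lookup m k)) (g \<otimes>\<^bsub>G\<^esub> h))"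
      using member_le_sum[OF h, of "\<lambda>k. Poly_Mapping.lookup
        (Poly_Mapping.single (g \<otimes>\<^bsub>G\<^esub> k) (Poly_Mapping.lookup m k)) (g \<otimes>\<^bsub>G\<^esub> h)"]
      by simp
    also have "\<dots> = Poly_Mapping.lookup (monomial_action G g m) (g \<otimes>\<^bsub>G\<^esub> h)"
      by (simp add: monomial_action_def lookup_sum)
    finally show False
      using h eq by (simp add: in_keys_iff)
  qed
qed (simp add: monomial_action_zero)

text \<open>Equivariance of the retraction. The hypothesis \<open>\<phi> g 0 = 0\<close> covers
  polynomials without constant term, over whose keys the sum misses the monomial 0.\<close>

lemma lookup_poly_action_zero:
  assumes "\<phi> g 0 = 0"
  shows "Poly_Mapping.lookup (poly_action G \<phi> g p) 0 = \<phi> g (Poly_Mapping.lookup p 0)"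
proof -
  have "Poly_Mapping.lookup (poly_action G \<phi> g p) 0 =
      (\<Sum>m\<in>Poly_Mapping.keys p. if m = 0 then \<phi> g (Poly_Mapping.lookup p m) else 0)"
    unfolding poly_action_def lookup_sum
    by (intro sum.cong) (auto simp: lookup_single when_def monomial_action_eq_zero_iff)
  also have "\<dots> = \<phi> g (Poly_Mapping.lookup p 0)"
    using assms by (simp add: sum.delta in_keys_iff)
  finally show ?thesis .
qed

text \<open>Equivariance of the embedding of the ring as constant polynomials.\<close>

lemma poly_action_single_zero:
  assumes "\<phi> g 0 = 0"
  shows "poly_action G \<phi> g (Poly_Mapping.single 0 a) = Poly_Mapping.single 0 (\<phi> g a)"
  using assms by (cases "a = 0") (simp_all add: poly_action_def monomial_action_zero)

context graded_ring_action
begin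

text \<open>The constant coefficient preserves degree and invariance and respects the ring
  operations, so it carries generators to generators; an invariant \<open>a\<close> is recovered
  from its constant polynomial.\<close>

lemma invariants_generated_by_poly_invariants:
  assumes "H \<subseteq> carrier G"
    and gen: "subring_generated poly_one
      (degree_upto (\<lambda>d. invariants H (poly_action G \<phi>) (poly_component A H d)) b)
        = invariants H (poly_action G \<phi>) (polys H)"
  shows "invariants H \<phi> UNIV \<subseteq> subring_generated 1 (degree_upto (\<lambda>d. invariants H \<phi> (A d)) b)"
proof
  let ?R = "\<lambda>d. invariants H (poly_action G \<phi>) (poly_component A H d)"
  let ?T = "subring_generated 1 (degree_upto (\<lambda>d. invariants H \<phi> (A d)) b)"
  let ?c = "\<lambda>p :: ('g, 'a) mpoly. Poly_Mapping.lookup p 0"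
  have comp: "?c p \<in> invariants H \<phi> (A d)" if p: "p \<in> ?R d" for p d
  proof -
    \<comment> \<open>The constant monomial has degree 0, so its coefficient has the full degree
      \<open>d\<close>; an absent constant term is 0, which lies in every component.\<close>
    have "?c p \<in> A d"
    proof (cases "0 \<in> Poly_Mapping.keys p")
      case True
      then obtain i where "i + monomial_degree (0 :: 'g \<Rightarrow>\<^sub>0 nat) = d" "?c p \<in> A i"
        using p unfolding invariants_def poly_component_def by blast
      then show ?thesis by (simp add: monomial_degree_def)
    next
      case False
      then show ?thesis using zero_mem by (simp add: in_keys_iff)
    qed
    moreover have "\<phi> h (?c p) = ?c p" if "h \<in> H" for h
      using p that assms(1) lookup_poly_action_zero[of \<phi> h G p]
      by (auto simp: invariants_def action_zero subset_iff)
    ultimately show ?thesis by (simp add: invariants_def)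
  qed
  have retract: "?c p \<in> ?T" if "p \<in> subring_generated poly_one (degree_upto ?R b)" for p
    using that
  proof induction
    case one
    then show ?case by (simp add: poly_one_def subring_generated.one)
  next
    case (incl p)
    then show ?case
      by (intro subring_generated.incl degree_upto_image[of ?R ?c]) (auto intro: comp simp: lookup_add)
  qed (auto simp: lookup_add lookup_mult_zero intro: subring_generated.intros)
  fix a assume "a \<in> invariants H \<phi> UNIV"
  then have "Poly_Mapping.single 0 a \<in> invariants H (poly_action G \<phi>) (polys H)"
    using assms(1)
    by (auto simp: invariants_def polys_def poly_action_single_zero action_zero subset_iff)
  then show "a \<in> ?T"
    using retract[of "Poly_Mapping.single 0 a"] gen by simp
qed

end

theorem theorem3p3:
  fixes G :: "('g, 'm) monoid_scheme"
    and A :: "nat \<Rightarrow> 'a :: {comm_ring, comm_monoid_mult} set"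
    and \<phi> :: "'g \<Rightarrow> 'a \<Rightarrow> 'a"
    and H :: "'g set"
  assumes "finite (carrier G)"
    and "graded_ring_action G A \<phi>"
    and "beta 1 UNIV A \<le> 1"
    and order_invertible: "(\<Sum>g\<in>carrier G. (1 :: 'a)) dvd 1"
    and "subgroup H G"
  shows "beta_invariants (carrier G) A \<phi>
           \<le> enat (card (rcosets\<^bsub>G\<^esub> H)) * beta_poly_invariants G H A \<phi>"
proof (cases "beta_poly_invariants G H A \<phi>")
  case (enat b)
  interpret graded_ring_action G A \<phi> by fact
  obtain u where "transfer 1 * u = 1"
    using order_invertible unfolding transfer_one by (metis dvd_def)
  moreover have "invariants H \<phi> UNIV \<subseteq> subring_generated 1 (degree_upto (\<lambda>d. invariants H \<phi> (A d)) b)"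
    using beta_attained[OF enat[unfolded beta_poly_invariants_def]] subgroup.subset[OF assms(5)]
    by (intro invariants_generated_by_poly_invariants) auto
  ultimately show ?thesis
    using beta_invariants_le_index[OF assms(1,5)] enat by simp
next
  case infinity
  interpret graded_ring_action G A \<phi> by fact
  \<comment> \<open>In \<open>enat\<close>, zero times infinity is 0, so the bound is infinite only
    because the index is nonzero.\<close>
  have "group G" using group_hom group_hom.axioms(1) by blast
  then have "carrier G \<noteq> {}"
    using monoid.one_closed[OF group.is_monoid] by blast
  then have "card (rcosets\<^bsub>G\<^esub> H) \<noteq> 0"
    using assms(1) by (auto simp: RCOSETS_def)
  then show ?thesis using infinity by (simp add: enat_0_iff)
qed

end
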